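(* Let $\varphi:\mathcal C_2\to\mathcal C_2$ be the homeomorphism represented by the binary transducer $T^\varphi$ given in the context, and let $H_i=F^{\varphi^i}$ for $i\ge0$. The chain $$F=H_0>H_1>H_2>\cdots$$ has trivial intersection: $\bigcap_{i\ge0}H_i=\{1\}$.
   Context: $\mathcal C_2=\{0,1\}^{\mathbb N}$ with the lexicographic order. Thompson's group $F$ is the group of order-preserving homeomorphisms $f$ of $\mathcal C_2$ for which there are finite complete prefix codes $\{u_1<\dots<u_k\}$, $\{v_1<\dots<v_k\}$ of binary words (complete: the cylinders $u_i\mathcal C_2$ partition $\mathcal C_2$) with $f(u_i\omega)=v_i\omega$. $T^\varphi$ has states $\mathsf L,\mathsf R,\mathsf A,\mathsf B$, initial state $\mathsf L$; an entry $i\mid w\to s'$ in the row of $s$ means that in state $s$ on input $i$ it outputs the word $w$ ($\varepsilon$ the empty word) and moves to $s'$: $\mathsf L$: $0\mid0\to\mathsf L$, $1\mid1\to\mathsf R$; $\mathsf R$: $0\mid0\to\mathsf A$, $1\mid1\to\mathsf R$; $\mathsf A$: $0\mid00\to\mathsf A$, $1\mid\varepsilon\to\mathsf B$; $\mathsf B$: $0\mid01\to\mathsf A$, $1\mid1\to\mathsf R$. $\varphi(\omega)$ is the infinite output on input $\omega$ from $\mathsf L$; $\varphi$ is an order-preserving homeomorphism. $\varphi^i$ is the $i$-th iterate, and $F^{\varphi^i}=\{\varphi^i\circ f\circ\varphi^{-i}:f\in F\}$. *)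

theory Defs
  imports
    "HOL-Analysis.Analysis"
    "HOL-Algebra.Bij"
    "HOL-Library.Fun_Lexorder"
    "HOL-Library.Omega_Words_Fun"
    "HOL-Library.Disjoint_Sets"
    "HOL-Library.Sublist"
begin

text \<open>
  The Cantor space \<open>{0,1}\<^sup>\<nat>\<close> is the type \<^typ>\<open>bool word\<close>, that is
  \<^typ>\<open>nat \<Rightarrow> bool\<close>, with \<^term>\<open>False\<close> for the digit 0 and \<^term>\<open>True\<close> for
  the digit 1.  Its topology is the product topology.  The order \<open>\<le>\<close> of this type is the
  pointwise one, so the lexicographic order is \<^const>\<open>less_fun\<close>; finite words are compared by
  \<^const>\<open>ord_class.lexordp\<close>.
\<close>

definition order_homeo :: "(bool word \<Rightarrow> bool word) \<Rightarrow> bool" where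
  "order_homeo f \<longleftrightarrow> (\<exists>g. homeomorphism UNIV UNIV f g) \<and> monotone less_fun less_fun f"

definition cylinder :: "bool list \<Rightarrow> bool word set" where
  "cylinder u = range (\<lambda>\<omega>. u \<frown> \<omega>)"

definition complete_prefix_code :: "bool list set \<Rightarrow> bool" where
  "complete_prefix_code C \<longleftrightarrow>
     finite C \<and> (\<forall>u\<in>C. \<forall>v\<in>C. Sublist.prefix u v \<longrightarrow> u = v) \<and> partition_on UNIV (cylinder ` C)"

definition thompson_F :: "(bool word \<Rightarrow> bool word) set" where
  "thompson_F =
     {f. order_homeo f \<and>
         (\<exists>us vs. length us = length vs
            \<and> sorted_wrt ord_class.lexordp us \<and> complete_prefix_code (set us)
            \<and> sorted_wrt ord_class.lexordp vs \<and> complete_prefix_code (set vs)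
            \<and> (\<forall>i<length us. \<forall>\<omega>. f (us ! i \<frown> \<omega>) = vs ! i \<frown> \<omega>))}"

text \<open>
  A transducer is given by its transition function, which sends a state and an input letter to
  the word written and the next state.
\<close>

type_synonym 's transducer = "'s \<Rightarrow> bool \<Rightarrow> bool list \<times> 's"

fun out_word :: "'s transducer \<Rightarrow> 's \<Rightarrow> bool list \<Rightarrow> bool list" where
  "out_word T s [] = []"
| "out_word T s (x # xs) = fst (T s x) @ out_word T (snd (T s x)) xs"

text \<open>
  The \<open>n\<close>-th letter of the infinite output is read off the output on an input prefix that is
  long enough for the letter to have been written.
\<close>

definition transducer_map :: "'s transducer \<Rightarrow> 's \<Rightarrow> bool word \<Rightarrow> bool word" where
  "transducer_map T s \<omega> =
     (\<lambda>n. out_word T s (Omega_Words_Fun.prefix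
            (LEAST k. n < length (out_word T s (Omega_Words_Fun.prefix k \<omega>))) \<omega>) ! n)"

datatype state = St_L | St_R | St_A | St_B

fun T_phi :: "state transducer" where
  "T_phi St_L False = ([False], St_L)"
| "T_phi St_L True = ([True], St_R)"
| "T_phi St_R False = ([False], St_A)"
| "T_phi St_R True = ([True], St_R)"
| "T_phi St_A False = ([False, False], St_A)"
| "T_phi St_A True = ([], St_B)"
| "T_phi St_B False = ([False, True], St_A)"
| "T_phi St_B True = ([True], St_R)"

definition phi :: "bool word \<Rightarrow> bool word" where
  "phi = transducer_map T_phi St_L"

text \<open>The output of \<^const>\<open>T_phi\<close> is infinite on every input, so the least \<open>k\<close> above exists.\<close>

lemma length_le_out_word:
  "length w \<le> 2 * length (out_word T_phi s w) + (if s = St_B then 0 else 1)"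
proof (induction w arbitrary: s)
  case (Cons x xs)
  show ?case
    using Cons.IH[of "snd (T_phi s x)"] by (cases s; cases x) (auto split: if_splits)
qed simp

lemma out_word_T_phi_unbounded:
  "\<exists>k. n < length (out_word T_phi s (Omega_Words_Fun.prefix k \<omega>))"
proof
  show "n < length (out_word T_phi s (Omega_Words_Fun.prefix (2 * n + 2) \<omega>))"
    using length_le_out_word[of "Omega_Words_Fun.prefix (2 * n + 2) \<omega>" s]
    by (simp split: if_splits)
qed

definition conj_F :: "nat \<Rightarrow> (bool word \<Rightarrow> bool word) set" where
  "conj_F i = {(phi ^^ i) \<circ> f \<circ> inv_into UNIV (phi ^^ i) | f. f \<in> thompson_F}"

end

theory Submission
  imports Defs
begin

text \<open>
  In the non-initial states the letter 0 always leads to \<open>A\<close>, and reading a run of zeros in \<open>A\<close>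
  doubles its length.  Hence, if \<open>f = \<phi> \<circ> g \<circ> \<phi>\<^sup>-\<^sup>1\<close> with \<open>g \<in> F\<close> acts to the right of a dyadic point
  \<open>w10\<^sup>\<infinity>\<close> by \<open>w10\<^sup>b\<omega> \<mapsto> 0\<^sup>jw10\<^sup>c\<omega>\<close>, then \<open>c - b\<close> is twice the corresponding difference for \<open>g\<close> at
  the \<open>\<phi>\<close>-preimage of that point; this uses that \<open>\<phi>\<close> commutes with prepending \<open>0\<^sup>j\<close>.  For \<open>f\<close> in
  the intersection, \<open>c - b\<close> is divisible by all powers of 2, so it vanishes.

  Near \<open>0\<^sup>\<infinity>\<close> such an \<open>f\<close> (or its inverse) prepends \<open>0\<^sup>j\<close> for some \<open>j\<close>.  Sweeping through the
  cylinders from left to right, the order forces \<open>f\<close> to map the gap \<open>(w01\<^sup>\<infinity>, w10\<^sup>\<infinity>)\<close> at the end of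
  a cylinder to a gap, and the vanishing of \<open>c - b\<close> propagates the formula \<open>\<omega> \<mapsto> 0\<^sup>j\<omega>\<close> across it.
  Surjectivity leaves only \<open>j = 0\<close>.

  The inclusions are strict because conjugation by \<open>\<phi>\<close> is injective: one equality would make all
  \<open>H\<^sub>i\<close>, and thus the intersection, equal to the nontrivial group \<open>F\<close>.
\<close>

hide_const (open) Sublist.prefix Sublist.suffix

section \<open>The order and topology of the Cantor space\<close>

lemma prefix_nth_suffix: "x = prefix k x \<frown> x k ## suffix (Suc k) x"
proof -
  have "suffix k x = x k ## suffix (Suc k) x"
  proof
    show "suffix k x n = (x k ## suffix (Suc k) x) n" for n
      by (cases n) auto
  qed
  then show ?thesis
    using prefix_suffix[of x k] by simp
qed

text \<open>The word \<open>w\<close> ends just before the first letter where \<open>x\<close> and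
  \<open>y\<close> differ. In this form the order can be followed through a transducer by rewriting
  along \<open>w\<close>.\<close>

lemma less_fun_iff_split:
  "less_fun x y \<longleftrightarrow> (\<exists>w a b. x = w \<frown> False ## a \<and> y = w \<frown> True ## b)" for x y :: "bool word"
proof
  assume "less_fun x y"
  then obtain k where k: "x k < y k" "\<And>i. i < k \<Longrightarrow> x i = y i"
    by (auto elim: less_funE)
  have px: "prefix k x = prefix k y"
    using k(2) by (auto intro: nth_equalityI)
  have "x = prefix k x \<frown> x k ## suffix (Suc k) x"
    by (rule prefix_nth_suffix)
  moreover have "y = prefix k y \<frown> y k ## suffix (Suc k) y"
    by (rule prefix_nth_suffix)
  moreover have "x k = False" "y k = True"
    using k(1) by auto
  ultimately show "\<exists>w a b. x = w \<frown> False ## a \<and> y = w \<frown> True ## b"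
    using px by metis
next
  assume "\<exists>w a b. x = w \<frown> False ## a \<and> y = w \<frown> True ## b"
  then obtain w a b where xy: "x = w \<frown> False ## a" "y = w \<frown> True ## b"
    by blast
  then show "less_fun x y"
    by (intro less_funI exI[of _ "length w"]) auto
qed

lemma less_fun_conc [simp]: "less_fun (w \<frown> x) (w \<frown> y) \<longleftrightarrow> less_fun x y" for x y :: "bool word"
proof
  assume "less_fun (w \<frown> x) (w \<frown> y)"
  then obtain k where k: "(w \<frown> x) k < (w \<frown> y) k" "\<And>i. i < k \<Longrightarrow> (w \<frown> x) i = (w \<frown> y) i"
    by (auto elim: less_funE)
  then have "length w \<le> k"
    using conc_fst[of k w x] conc_fst[of k w y] by (cases "k < length w") auto
  then have "x (k - length w) < y (k - length w)"
    using k(1) by simp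
  moreover have "x i = y i" if "i < k - length w" for i
    using k(2)[of "length w + i"] that by simp
  ultimately show "less_fun x y"
    by (blast intro: less_funI)
next
  assume "less_fun x y"
  then obtain v a b where "x = v \<frown> False ## a" "y = v \<frown> True ## b"
    unfolding less_fun_iff_split by blast
  then have "w \<frown> x = (w @ v) \<frown> False ## a" "w \<frown> y = (w @ v) \<frown> True ## b"
    by simp_all
  then show "less_fun (w \<frown> x) (w \<frown> y)"
    unfolding less_fun_iff_split by blast
qed

lemma less_fun_build [simp]:
  "less_fun (a ## x) (b ## y) \<longleftrightarrow> a < b \<or> a = b \<and> less_fun x y" for x y :: "bool word"
proof -
  have "less_fun (a ## x) (a ## y) \<longleftrightarrow> less_fun x y"
    using less_fun_conc[of "[a]"] by simp
  moreover have lt: "less_fun (False ## x) (True ## y)" for x y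
    by (auto simp: less_fun_iff_split intro!: exI[of _ "[]"])
  moreover have "\<not> less_fun (True ## x) (False ## y)"
    using lt[of y x] less_fun_asym by blast
  ultimately show ?thesis
    by (cases a; cases b) auto
qed

lemma less_fun_total: "x \<noteq> y \<Longrightarrow> less_fun x y \<or> less_fun y x" for x y :: "bool word"
proof -
  assume "x \<noteq> y"
  then have ex: "\<exists>k. x k \<noteq> y k" by blast
  define k where "k = (LEAST k. x k \<noteq> y k)"
  have "x k \<noteq> y k"
    unfolding k_def using ex by (rule LeastI_ex)
  moreover have "x i = y i" if "i < k" for i
    using not_less_Least that unfolding k_def by blast
  ultimately show ?thesis
    unfolding less_fun_def by (metis linorder_neqE)
qed

lemma mono_less_fun_iff:
  fixes f :: "bool word \<Rightarrow> bool word"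
  assumes "monotone less_fun less_fun f"
  shows "less_fun (f x) (f y) \<longleftrightarrow> less_fun x y"
proof
  assume fxy: "less_fun (f x) (f y)"
  show "less_fun x y"
  proof (rule ccontr)
    assume "\<not> less_fun x y"
    then have "x = y \<or> less_fun y x"
      using less_fun_total by blast
    then have "f x = f y \<or> less_fun (f y) (f x)"
      using assms by (auto simp: monotone_def)
    then show False
      using fxy less_fun_asym less_fun_irrefl by metis
  qed
next
  assume "less_fun x y"
  then show "less_fun (f x) (f y)"
    using assms by (simp add: monotone_def)
qed

lemma mono_less_fun_inj:
  fixes f :: "bool word \<Rightarrow> bool word"
  assumes "monotone less_fun less_fun f"
  shows "inj f"
proof (rule injI, rule ccontr)
  fix x y
  assume "f x = f y" "x \<noteq> y"
  then show False
    using less_fun_total[of x y] mono_less_fun_iff[OF assms, of x y] mono_less_fun_iff[OF assms, of y x]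
      less_fun_irrefl[of "f x"] by auto
qed

section \<open>Compactness, separation and continuity in the Cantor space\<close>

lemma compact_bool_word: "compact (UNIV :: bool word set)"
proof -
  have "compact_space (product_topology (\<lambda>_. euclidean :: bool topology) (UNIV :: nat set))"
    by (subst compact_space_product_topology) (simp add: compact_space_def finite_imp_compact)
  then have "compact_space (euclidean :: bool word topology)"
    by (simp only: euclidean_product_topology)
  then show ?thesis
    by (simp add: compact_space_def)
qed

lemma mem_cylinder_iff: "x \<in> cylinder u \<longleftrightarrow> prefix (length u) x = u"
  unfolding cylinder_def by (metis prefix_conc_length prefix_suffix rangeE rangeI)

lemma open_cylinder: "open (cylinder u)"
proof -
  have "open ((\<lambda>x::bool word. x i) -` {b})" for i b
    by (rule open_vimage[OF open_discrete continuous_on_product_coordinates])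
  then have "open (\<Inter>i<length u. (\<lambda>x::bool word. x i) -` {u ! i})"
    by (intro open_INT) auto
  moreover have "cylinder u = (\<Inter>i<length u. (\<lambda>x::bool word. x i) -` {u ! i})"
  proof (intro Set.set_eqI)
    fix x :: "bool word"
    show "x \<in> cylinder u \<longleftrightarrow> x \<in> (\<Inter>i<length u. (\<lambda>x::bool word. x i) -` {u ! i})"
      unfolding mem_cylinder_iff list_eq_iff_nth_eq by (auto simp: Ball_def)
  qed
  ultimately show ?thesis
    by (simp only:)
qed

text \<open>A coordinate that depends only on a finite prefix is constant on an open cylinder around
  each point.\<close>

lemma continuous_on_bool_wordI:
  fixes f :: "bool word \<Rightarrow> bool word"
  assumes "\<And>x n. \<exists>k. \<forall>y. prefix k y = prefix k x \<longrightarrow> f y n = f x n"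
  shows "continuous_on UNIV f"
proof (rule continuous_on_coordinatewise_then_product)
  fix n
  have "open ((\<lambda>x. f x n) -` B)" for B
  proof (rule Topological_Spaces.openI)
    fix x
    assume x: "x \<in> (\<lambda>x. f x n) -` B"
    obtain k where k: "\<forall>y. prefix k y = prefix k x \<longrightarrow> f y n = f x n"
      using assms by blast
    have "cylinder (prefix k x) \<subseteq> (\<lambda>x. f x n) -` B"
    proof
      fix y
      assume "y \<in> cylinder (prefix k x)"
      then have "prefix k y = prefix k x"
        by (simp add: mem_cylinder_iff)
      then have "f y n = f x n"
        using k by blast
      then show "y \<in> (\<lambda>x. f x n) -` B"
        using x by simp
    qed
    moreover have "x \<in> cylinder (prefix k x)"
      by (simp add: mem_cylinder_iff)
    ultimately show "\<exists>T. open T \<and> x \<in> T \<and> T \<subseteq> (\<lambda>x. f x n) -` B"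
      using open_cylinder by blast
  qed
  then show "continuous_on UNIV (\<lambda>x. f x n)"
    by (simp add: continuous_on_open_vimage)
qed

lemma compact_imp_closed_bool_word:
  fixes S :: "bool word set"
  assumes "compact S"
  shows "closed S"
proof -
  have "Hausdorff_space (euclidean :: bool topology)"
    unfolding Hausdorff_space_def
  proof (intro allI impI)
    fix x y :: bool
    assume "x \<in> topspace euclidean \<and> y \<in> topspace euclidean \<and> x \<noteq> y"
    then show "\<exists>U V. openin euclidean U \<and> openin euclidean V \<and> x \<in> U \<and> y \<in> V \<and> disjnt U V"
      by (intro exI[of _ "{x}"] exI[of _ "{y}"]) (simp add: open_discrete)
  qed
  then have "Hausdorff_space (product_topology (\<lambda>_. euclidean :: bool topology) (UNIV :: nat set))"
    by (simp only: Hausdorff_space_product_topology) simp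
  then have "Hausdorff_space (euclidean :: bool word topology)"
    by (simp only: euclidean_product_topology)
  then show ?thesis
    using compactin_imp_closedin[of euclidean S] assms by simp
qed

text \<open>Strict monotonicity for a total order gives injectivity. A continuous bijection of a
  compact Hausdorff space is a homeomorphism, since it maps closed sets to compact, thus closed,
  sets.\<close>

lemma order_homeoI:
  fixes f :: "bool word \<Rightarrow> bool word"
  assumes "monotone less_fun less_fun f" "surj f" "continuous_on UNIV f"
  shows "order_homeo f"
proof -
  have bij: "bij f"
    by (simp add: assms(1,2) bij_def mono_less_fun_inj)
  have "closed (inv_into UNIV f -` B)" if "closed B" for B
  proof -
    have "compact (f ` B)"
      using that compact_Int_closed[OF compact_bool_word that] assms(3)
      by (intro compact_continuous_image) (auto intro: continuous_on_subset)
    moreover have "inv_into UNIV f -` B = f ` B"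
      by (rule bij_vimage_eq_inv_image[OF bij_imp_bij_inv[OF bij], unfolded inv_inv_eq[OF bij]])
    ultimately show ?thesis
      by (simp add: compact_imp_closed_bool_word)
  qed
  then have "continuous_on UNIV (inv_into UNIV f)"
    by (simp add: continuous_on_closed_vimage)
  then have "homeomorphism UNIV UNIV f (inv_into UNIV f)"
    using assms bij bij_imp_bij_inv[OF bij]
    by (auto simp: homeomorphism_def bij_is_surj bij_is_inj surj_f_inv_f inv_f_f)
  then show ?thesis
    using assms(1) order_homeo_def by blast
qed

lemma order_homeo_bij: "order_homeo f \<Longrightarrow> bij f"
  unfolding order_homeo_def homeomorphism_def bij_def
  using mono_less_fun_inj by blast

lemma order_homeo_less_iff: "order_homeo f \<Longrightarrow> less_fun (f x) (f y) \<longleftrightarrow> less_fun x y"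
  using mono_less_fun_iff order_homeo_def by blast

lemma order_homeo_id: "order_homeo id"
  by (rule order_homeoI) (simp_all add: monotone_def)

lemma order_homeo_comp:
  assumes "order_homeo f" "order_homeo g"
  shows "order_homeo (f \<circ> g)"
proof -
  obtain f' g' where "homeomorphism UNIV UNIV f f'" "homeomorphism UNIV UNIV g g'"
    using assms unfolding order_homeo_def by blast
  then have "homeomorphism UNIV UNIV (f \<circ> g) (g' \<circ> f')"
    using homeomorphism_compose by blast
  then show ?thesis
    using assms unfolding order_homeo_def monotone_def by auto
qed

lemma order_homeo_inv:
  assumes "order_homeo f"
  shows "order_homeo (inv_into UNIV f)"
proof -
  obtain g where g: "homeomorphism UNIV UNIV f g"
    using assms order_homeo_def by blast
  then have "inv_into UNIV f = g"
    by (metis UNIV_I homeomorphism_def inv_equality)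
  moreover have "monotone less_fun less_fun (inv_into UNIV f)"
  proof (rule monotoneI)
    fix x y :: "bool word"
    assume "less_fun x y"
    then show "less_fun (inv_into UNIV f x) (inv_into UNIV f y)"
      using order_homeo_less_iff[OF assms, of "inv_into UNIV f x" "inv_into UNIV f y"]
        surj_f_inv_f[OF bij_is_surj[OF order_homeo_bij[OF assms]]] by simp
  qed
  ultimately show ?thesis
    using g homeomorphism_symD order_homeo_def by blast
qed

text \<open>The image is compact, hence closed, and \<open>y\<close> is the limit of values
  \<open>f (x n)\<close> that agree with \<open>y\<close> on the first \<open>n\<close>
  letters.\<close>

lemma surj_if_dense:
  fixes f :: "bool word \<Rightarrow> bool word"
  assumes "continuous_on UNIV f" "\<And>n y. \<exists>x. prefix n (f x) = prefix n y"
  shows "surj f"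
proof -
  have "y \<in> range f" for y
  proof -
    have "\<forall>n. \<exists>x. prefix n (f x) = prefix n y"
      using assms(2) by blast
    from choice[OF this] obtain x where x: "\<And>n. prefix n (f (x n)) = prefix n y"
      by blast
    have "limitin (product_topology (\<lambda>_. euclidean :: bool topology) UNIV) (\<lambda>n. f (x n)) y sequentially"
      unfolding limitin_componentwise
    proof (intro conjI ballI)
      fix i
      have "f (x n) i = y i" if "i < n" for n
        using x[of n] that by (metis add_0 diff_zero subsequence_nth)
      then have "\<forall>\<^sub>F n in sequentially. f (x n) i = y i"
        by (intro eventually_mono[OF eventually_gt_at_top[of i]])
      then show "limitin euclidean (\<lambda>n. f (x n) i) (y i) sequentially"
        unfolding limitin_canonical_iff by (rule tendsto_eventually)
    qed auto
    then have "(\<lambda>n. f (x n)) \<longlonglongrightarrow> y"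
      by (simp only: euclidean_product_topology limitin_canonical_iff)
    then show ?thesis
      using compact_imp_closed_bool_word[OF compact_continuous_image[OF assms(1) compact_bool_word]]
      by (intro Lim_in_closed_set[where f = "\<lambda>n. f (x n)" and F = sequentially]) auto
  qed
  then show ?thesis
    by blast
qed

section \<open>The maps of the transducer\<close>

abbreviation run :: "state \<Rightarrow> bool list \<Rightarrow> state" where
  "run \<equiv> foldl (\<lambda>s b. snd (T_phi s b))"

abbreviation phi_at :: "state \<Rightarrow> bool word \<Rightarrow> bool word" where
  "phi_at \<equiv> transducer_map T_phi"

lemma out_word_append: "out_word T_phi s (u @ v) = out_word T_phi s u @ out_word T_phi (run s u) v"
  by (induction u arbitrary: s) auto

text \<open>Outputs on longer prefixes extend those on shorter ones, so the least \<open>k\<close>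
  in \<open>transducer_map\<close> may be replaced by any larger one.\<close>

lemma phi_at_nth:
  assumes "n < length (out_word T_phi s (prefix k x))"
  shows "phi_at s x n = out_word T_phi s (prefix k x) ! n"
proof -
  define m where "m = (LEAST k. n < length (out_word T_phi s (prefix k x)))"
  have "m \<le> k"
    unfolding m_def using assms by (rule Least_le)
  moreover have "n < length (out_word T_phi s (prefix m x))"
    unfolding m_def using assms by (rule LeastI)
  ultimately show ?thesis
    using subsequence_append[of x m "k - m"]
    unfolding transducer_map_def m_def[symmetric] by (simp add: out_word_append nth_append)
qed

lemma phi_at_conc: "phi_at s (u \<frown> x) = out_word T_phi s u \<frown> phi_at (run s u) x"
proof
  fix n
  obtain k where k: "n < length (out_word T_phi s (prefix k (u \<frown> x)))"
    using out_word_T_phi_unbounded by blast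
  have "prefix (k + length u) (u \<frown> x) = u @ prefix k x"
    by simp
  moreover have "n < length (out_word T_phi s (prefix (k + length u) (u \<frown> x)))"
    using k subsequence_append[of "u \<frown> x" k "length u"] by (simp add: out_word_append)
  ultimately have n: "n < length (out_word T_phi s u @ out_word T_phi (run s u) (prefix k x))"
      "phi_at s (u \<frown> x) n = (out_word T_phi s u @ out_word T_phi (run s u) (prefix k x)) ! n"
    using phi_at_nth[of n s "u \<frown> x" "k + length u"] by (simp_all add: out_word_append)
  show "phi_at s (u \<frown> x) n = (out_word T_phi s u \<frown> phi_at (run s u) x) n"
  proof (cases "n < length (out_word T_phi s u)")
    case True
    then show ?thesis
      using n by (simp add: nth_append)
  next
    case False
    then show ?thesis
      using n phi_at_nth[of "n - length (out_word T_phi s u)" "run s u" x k] by (simp add: nth_append)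
  qed
qed

lemma phi_at_build [simp]: "phi_at s (b ## x) = fst (T_phi s b) \<frown> phi_at (snd (T_phi s b)) x"
  using phi_at_conc[of s "[b]" x] by simp

lemma word_cases: obtains b x where "w = b ## x"
  by (metis build_first)

lemma phi_at_mono: "monotone less_fun less_fun (phi_at s)"
proof
  fix x y :: "bool word"
  assume "less_fun x y"
  then obtain w a b where xy: "x = w \<frown> False ## a" "y = w \<frown> True ## b"
    unfolding less_fun_iff_split by blast
  have "less_fun (phi_at t (False ## a)) (phi_at t (True ## b))" for t
  proof (cases t)
    \<comment> \<open>\<open>St_A\<close> writes nothing on \<open>True\<close>, so one more letter
      is needed to see that the output starts with 01 or 1, above 00.\<close>
    case St_A
    obtain c b' where "b = c ## b'"
      by (rule word_cases)
    then show ?thesis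
      by (cases c) (auto simp: St_A)
  qed auto
  then show "less_fun (phi_at s x) (phi_at s y)"
    by (simp add: xy phi_at_conc del: phi_at_build)
qed

lemma phi_at_continuous: "continuous_on UNIV (phi_at s)"
proof (rule continuous_on_bool_wordI)
  fix x n
  obtain k where "n < length (out_word T_phi s (prefix k x))"
    using out_word_T_phi_unbounded by blast
  then show "\<exists>k. \<forall>y. prefix k y = prefix k x \<longrightarrow> phi_at s y n = phi_at s x n"
    by (metis phi_at_nth)
qed

text \<open>\<open>St_B\<close> is excluded because its output starts with 01 or 1, never with 00.
  The induction takes two letters at a time since from \<open>St_A\<close> the words 00 and 01 are
  written as blocks.\<close>

lemma phi_at_dense: "s \<noteq> St_B \<Longrightarrow> \<exists>x z. phi_at s x = v \<frown> z"
proof (induction v arbitrary: s rule: induct_list012)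
  case (2 b)
  \<comment> \<open>The letter is repeated for the sake of \<open>St_A\<close>, whose output starts
    with 1 only on inputs starting with 11.\<close>
  then have "\<exists>z. phi_at s (b ## b ## undefined) = [b] \<frown> z"
    by (cases s; cases b) auto
  then show ?case
    by blast
next
  case (3 a b v)
  have tail: "\<exists>x z. phi_at t x = b ## v \<frown> z" if "t \<noteq> St_B" for t
    using 3(2)[OF that] by simp
  show ?case
  proof (cases "s = St_A")
    case False
    then have "\<exists>t. t \<noteq> St_B \<and> T_phi s a = ([a], t)"
      using 3(3) by (cases s; cases a) auto
    then obtain t where t: "t \<noteq> St_B" "T_phi s a = ([a], t)"
      by blast
    obtain x z where "phi_at t x = b ## v \<frown> z"
      using tail t by blast
    then have "phi_at s (a ## x) = (a # b # v) \<frown> z"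
      using t by simp
    then show ?thesis
      by blast
  next
    case True
    show ?thesis
    proof (cases a)
      case True
      obtain x z where "phi_at St_R x = b ## v \<frown> z"
        using tail by blast
      then have "phi_at s (True ## True ## x) = (a # b # v) \<frown> z"
        using True \<open>s = St_A\<close> by simp
      then show ?thesis
        by blast
    next
      case False
      obtain x z where x: "phi_at St_A x = v \<frown> z"
        using 3(1)[of St_A] by auto
      \<comment> \<open>From \<open>St_A\<close>, input 0 writes 00 and input 10 writes 01; both
        return to \<open>St_A\<close>.\<close>
      have "phi_at s (if b then True ## False ## x else False ## x) = (a # b # v) \<frown> z"
        using False \<open>s = St_A\<close> x by simp
      then show ?thesis
        by blast
    qed
  qed
qed auto

lemma phi_at_order_homeo:
  assumes "s \<noteq> St_B"
  shows "order_homeo (phi_at s)"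
proof (rule order_homeoI[OF phi_at_mono surj_if_dense phi_at_continuous])
  fix n and y :: "bool word"
  obtain x z where "phi_at s x = prefix n y \<frown> z"
    using phi_at_dense assms by blast
  then have "prefix n (phi_at s x) = prefix n y"
    by simp
  then show "\<exists>x. prefix n (phi_at s x) = prefix n y"
    by blast
qed (rule phi_at_continuous)

section \<open>Thompson's group by local prefix replacement\<close>

definition replaces_prefix :: "(bool word \<Rightarrow> bool word) \<Rightarrow> bool list \<Rightarrow> bool" where
  "replaces_prefix f u \<longleftrightarrow> (\<exists>v. \<forall>x. f (u \<frown> x) = v \<frown> x)"

text \<open>This pointwise form of membership in \<open>thompson_F\<close> (see
  \<open>thompson_F_iff\<close>) avoids ordered prefix codes and is easier to check for
  compositions, inverses and conjugates.\<close>

definition locally_prefix_replacing :: "(bool word \<Rightarrow> bool word) \<Rightarrow> bool" where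
  "locally_prefix_replacing f \<longleftrightarrow> (\<forall>x. \<exists>k. replaces_prefix f (prefix k x))"

lemma replaces_prefix_append: "replaces_prefix f u \<Longrightarrow> replaces_prefix f (u @ w)"
  unfolding replaces_prefix_def by (metis conc_conc)

lemma locally_prefix_replacingI:
  assumes "\<And>x. \<exists>u y. x = u \<frown> y \<and> replaces_prefix f u"
  shows "locally_prefix_replacing f"
  unfolding locally_prefix_replacing_def by (metis assms prefix_conc_length)

text \<open>By compactness finitely many of the local cylinders cover the space, and a word at least
  as long as all of their defining words extends one of these.\<close>

lemma locally_prefix_replacing_uniform:
  assumes "locally_prefix_replacing f"
  obtains N where "\<And>u. N \<le> length u \<Longrightarrow> replaces_prefix f u"
proof -
  obtain k where k: "\<And>x. replaces_prefix f (prefix (k x) x)"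
    using assms unfolding locally_prefix_replacing_def by metis
  have "x \<in> cylinder (prefix (k x) x)" for x
    by (simp add: mem_cylinder_iff)
  then have "UNIV \<subseteq> (\<Union>x. cylinder (prefix (k x) x))"
    by blast
  then obtain D where D: "finite D" "UNIV \<subseteq> (\<Union>x\<in>D. cylinder (prefix (k x) x))"
    using compactE_image[OF compact_bool_word, of UNIV "\<lambda>x. cylinder (prefix (k x) x)"] open_cylinder
    by metis
  have "replaces_prefix f u" if "Max (k ` D) \<le> length u" for u
  proof -
    obtain x where x: "x \<in> D" "u \<frown> (\<lambda>_. False) \<in> cylinder (prefix (k x) x)"
      using D(2) by blast
    then have "k x \<le> length u"
      using that D(1) by (meson Max_ge finite_imageI imageI order_trans)
    then have "take (k x) u = prefix (k x) x"
      using x by (simp add: mem_cylinder_iff)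
    then show ?thesis
      using k[of x] replaces_prefix_append[of f "take (k x) u" "drop (k x) u"] by (metis append_take_drop_id)
  qed
  then show ?thesis
    using that by blast
qed

text \<open>All words of one length form a complete prefix code, listed here in lexicographic order
  to serve as the domain code in \<open>thompson_F_iff\<close>.\<close>

fun words :: "nat \<Rightarrow> bool list list" where
  "words 0 = [[]]"
| "words (Suc n) = map (Cons False) (words n) @ map (Cons True) (words n)"

lemma set_words: "set (words n) = {u. length u = n}"
proof (induction n)
  case (Suc n)
  show ?case
  proof (intro Set.set_eqI)
    fix u :: "bool list"
    show "u \<in> set (words (Suc n)) \<longleftrightarrow> u \<in> {u. length u = Suc n}"
      using Suc by (cases u; cases "hd u") auto
  qed
qed auto

lemma sorted_words: "sorted_wrt ord_class.lexordp (words n)"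
  by (induction n) (auto simp: sorted_wrt_append sorted_wrt_map)

lemma lexordp_imp_less_fun:
  fixes u v :: "bool list"
  assumes "length u = length v" "ord_class.lexordp u v"
  shows "less_fun (u \<frown> x) (v \<frown> y)"
  using assms by (induction u v rule: list_induct2) auto

lemma less_fun_imp_lexordp:
  fixes u v :: "bool list"
  assumes "\<And>x y. less_fun (u \<frown> x) (v \<frown> y)"
  shows "ord_class.lexordp u v"
  using assms
proof (induction u arbitrary: v)
  case Nil
  then have "v \<noteq> []"
    using Nil[of undefined undefined] less_fun_irrefl[of "undefined :: bool word"] by auto
  then show ?case
    by (cases v) auto
next
  case (Cons a u)
  \<comment> \<open>If \<open>v\<close> were empty, a suitable tail would make both words equal,
    against irreflexivity.\<close>
  have "v \<noteq> []"
    using Cons.prems[of undefined "(a # u) \<frown> undefined"] less_fun_irrefl[of "(a # u) \<frown> undefined"] by auto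
  then obtain b w where v: "v = b # w"
    by (cases v) auto
  then have "a < b \<or> a = b \<and> less_fun (u \<frown> x) (w \<frown> y)" for x y
    using Cons.prems[of x y] by simp
  then show ?case
    using Cons.IH[of w] v by auto
qed

text \<open>A bijection carries the partition into cylinders of words of length \<open>n\<close> to
  the cylinders of the words \<open>v u\<close>. Two of these that meet come from the same
  \<open>u\<close>, which also yields the prefix condition.\<close>

lemma complete_prefix_code_image:
  assumes "bij f" and v: "\<And>u x. length u = n \<Longrightarrow> f (u \<frown> x) = v u \<frown> x"
  shows "complete_prefix_code (v ` {u. length u = n})"
proof -
  have eq: "u = u'" if "length u = n" "length u' = n" "v u \<frown> x = v u' \<frown> y" for u u' x y
  proof -
    have "f (u \<frown> x) = f (u' \<frown> y)"
      using that v by simp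
    then have "u \<frown> x = u' \<frown> y"
      using assms(1) by (simp add: bij_is_inj inj_eq)
    then show ?thesis
      using that by simp
  qed
  have "finite {u :: bool list. length u = n}"
    using finite_lists_length_eq[of "UNIV :: bool set" n] by simp
  moreover have "v u = v u'" if u: "length u = n" "length u' = n" and pre: "Sublist.prefix (v u) (v u')" for u u'
  proof -
    obtain z where "v u' = v u @ z"
      using pre by (auto simp: prefix_def)
    then have "v u \<frown> z \<frown> undefined = v u' \<frown> undefined"
      by simp
    then show ?thesis
      using eq u by blast
  qed
  moreover have "partition_on UNIV (cylinder ` v ` {u. length u = n})"
  proof (rule partition_onI)
    have "y \<in> \<Union> (cylinder ` v ` {u. length u = n})" for y
    proof -
      obtain x where x: "y = f x"
        using assms(1) by (metis bij_pointE)
      have "y = v (prefix n x) \<frown> suffix n x"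
        using v[of "prefix n x" "suffix n x"] x by simp
      then show ?thesis
        unfolding cylinder_def by force
    qed
    then show "\<Union> (cylinder ` v ` {u. length u = n}) = UNIV"
      by blast
    show "disjnt p q" if "p \<in> cylinder ` v ` {u. length u = n}" "q \<in> cylinder ` v ` {u. length u = n}" "p \<noteq> q"
      for p q
    proof -
      obtain u u' where "length u = n" "length u' = n" "p = cylinder (v u)" "q = cylinder (v u')"
        using \<open>p \<in> _\<close> \<open>q \<in> _\<close> by auto
      then show ?thesis
        using eq[of u u'] \<open>p \<noteq> q\<close> unfolding disjnt_def cylinder_def by blast
    qed
    show "{} \<notin> cylinder ` v ` {u. length u = n}"
      unfolding cylinder_def by auto
  qed
  ultimately show ?thesis
    unfolding complete_prefix_code_def by auto
qed

text \<open>The code cylinder around a point gives the local form. Conversely, a uniform length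
  \<open>n\<close> gives the domain code \<open>words n\<close>, and monotonicity of
  \<open>f\<close> sorts the target words.\<close>

lemma thompson_F_iff: "f \<in> thompson_F \<longleftrightarrow> order_homeo f \<and> locally_prefix_replacing f"
proof
  assume f: "f \<in> thompson_F"
  then obtain us vs where uv: "length us = length vs" "complete_prefix_code (set us)"
      "\<forall>i<length us. \<forall>x. f (us ! i \<frown> x) = vs ! i \<frown> x"
    unfolding thompson_F_def by blast
  have "locally_prefix_replacing f"
  proof (rule locally_prefix_replacingI)
    fix x
    obtain u where "u \<in> set us" "x \<in> cylinder u"
      using uv(2) unfolding complete_prefix_code_def partition_on_def by blast
    then show "\<exists>u y. x = u \<frown> y \<and> replaces_prefix f u"
      using uv(3) unfolding replaces_prefix_def cylinder_def by (metis in_set_conv_nth rangeE)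
  qed
  then show "order_homeo f \<and> locally_prefix_replacing f"
    using f by (simp add: thompson_F_def)
next
  assume f: "order_homeo f \<and> locally_prefix_replacing f"
  then obtain n where "\<And>u. n \<le> length u \<Longrightarrow> replaces_prefix f u"
    using locally_prefix_replacing_uniform by blast
  then obtain v where v: "\<And>u x. length u = n \<Longrightarrow> f (u \<frown> x) = v u \<frown> x"
    unfolding replaces_prefix_def by (metis order_refl)
  have "ord_class.lexordp (v u) (v u')" if "length u = n" "length u' = n" "ord_class.lexordp u u'" for u u'
  proof (rule less_fun_imp_lexordp)
    fix x y
    have "less_fun (u \<frown> x) (u' \<frown> y)"
      using lexordp_imp_less_fun that by simp
    then show "less_fun (v u \<frown> x) (v u' \<frown> y)"
      using order_homeo_less_iff f v that by metis
  qed
  then have "sorted_wrt ord_class.lexordp (map v (words n))"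
    unfolding sorted_wrt_map
    by (intro sorted_wrt_mono_rel[OF _ sorted_words]) (auto simp: set_words)
  moreover have "complete_prefix_code (set (map v (words n)))"
    using complete_prefix_code_image[of f n v] v f order_homeo_bij by (simp add: set_words)
  moreover have "complete_prefix_code (set (words n))"
    using complete_prefix_code_image[of id n id] by (simp add: set_words)
  moreover have "length (words n ! i) = n" if "i < length (words n)" for i
    using that set_words nth_mem by blast
  ultimately show "f \<in> thompson_F"
    using f sorted_words[of n] v unfolding thompson_F_def mem_Collect_eq
    by (intro conjI exI[where x = "words n"] exI[where x = "map v (words n)"]) auto
qed

lemma thompson_F_id: "id \<in> thompson_F"
  unfolding thompson_F_iff
proof
  show "locally_prefix_replacing id"
    unfolding locally_prefix_replacing_def replaces_prefix_def by auto
qed (rule order_homeo_id)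

lemma thompson_F_comp:
  assumes "f \<in> thompson_F" "g \<in> thompson_F"
  shows "f \<circ> g \<in> thompson_F"
  unfolding thompson_F_iff
proof
  show "order_homeo (f \<circ> g)"
    using assms order_homeo_comp by (simp add: thompson_F_iff)
  obtain n where n: "\<And>u. n \<le> length u \<Longrightarrow> replaces_prefix f u"
    using assms(1) locally_prefix_replacing_uniform by (auto simp: thompson_F_iff)
  show "locally_prefix_replacing (f \<circ> g)"
  proof (rule locally_prefix_replacingI)
    fix x
    obtain k v where v: "\<And>y. g (prefix k x \<frown> y) = v \<frown> y"
      using assms(2) unfolding thompson_F_iff locally_prefix_replacing_def replaces_prefix_def by blast
    \<comment> \<open>The next \<open>n\<close> letters are carried along, so that the word
      \<open>v @ z\<close> reached by \<open>g\<close> is long enough for \<open>f\<close>.\<close>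
    define z where "z = x [k \<rightarrow> k + n]"
    have "replaces_prefix f (v @ z)"
      using n[of "v @ z"] by (simp add: z_def)
    then have "replaces_prefix (f \<circ> g) (prefix k x @ z)"
      using v unfolding replaces_prefix_def by (metis comp_apply conc_conc)
    moreover have "x = (prefix k x @ z) \<frown> suffix (k + n) x"
      using prefix_suffix[of x "k + n"] by (simp only: subsequence_append z_def)
    ultimately show "\<exists>u y. x = u \<frown> y \<and> replaces_prefix (f \<circ> g) u"
      by blast
  qed
qed

lemma thompson_F_inv:
  assumes "f \<in> thompson_F"
  shows "inv_into UNIV f \<in> thompson_F"
  unfolding thompson_F_iff
proof
  have f: "order_homeo f"
    using assms by (simp add: thompson_F_iff)
  then show "order_homeo (inv_into UNIV f)"
    by (rule order_homeo_inv)
  have "bij f"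
    using f by (rule order_homeo_bij)
  show "locally_prefix_replacing (inv_into UNIV f)"
  proof (rule locally_prefix_replacingI)
    fix x
    obtain k v where v: "\<And>y. f (prefix k (inv_into UNIV f x) \<frown> y) = v \<frown> y"
      using assms unfolding thompson_F_iff locally_prefix_replacing_def replaces_prefix_def by blast
    have "inv_into UNIV f (v \<frown> y) = prefix k (inv_into UNIV f x) \<frown> y" for y
      using \<open>bij f\<close> v by (metis bij_inv_eq_iff)
    moreover have "x = v \<frown> suffix k (inv_into UNIV f x)"
      using \<open>bij f\<close> v[of "suffix k (inv_into UNIV f x)"] by (simp add: bij_is_surj surj_f_inv_f)
    ultimately show "\<exists>u y. x = u \<frown> y \<and> replaces_prefix (inv_into UNIV f) u"
      unfolding replaces_prefix_def by blast
  qed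
qed

section \<open>Gaps of the lexicographic order\<close>

abbreviation zeros :: "bool word" where "zeros \<equiv> \<lambda>_. False"
abbreviation ones :: "bool word" where "ones \<equiv> \<lambda>_. True"
abbreviation Z :: "nat \<Rightarrow> bool list" where "Z k \<equiv> replicate k False"

lemma replicate_conc_const [simp]: "replicate k b \<frown> (\<lambda>_. b) = (\<lambda>_. b)"
  by (rule ext) (simp add: conc_def)

lemma build_const [simp]: "b ## (\<lambda>_. b) = (\<lambda>_. b)"
proof
  show "(b ## (\<lambda>_. b)) n = b" for n
    by (cases n) auto
qed

lemma prefix_zeros: "prefix k zeros = Z k"
  by (rule nth_equalityI) auto

lemma not_less_zeros: "\<not> less_fun x zeros"
  by (auto simp: less_fun_def)

lemma not_ones_less: "\<not> less_fun ones x"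
  by (auto simp: less_fun_def)

lemma order_homeo_zeros:
  assumes "order_homeo f"
  shows "f zeros = zeros"
proof -
  obtain x where x: "f x = zeros"
    using order_homeo_bij[OF assms] by (metis bij_pointE)
  have "\<not> less_fun zeros x"
    using order_homeo_less_iff[OF assms, of zeros x] x not_less_zeros by simp
  then have "x = zeros"
    using less_fun_total[of zeros x] not_less_zeros[of x] by metis
  then show ?thesis
    using x by simp
qed

text \<open>Covering pairs are the gaps of the Cantor set. Being defined by the order alone, they
  are preserved by every order homeomorphism, which is how dyadic points are tracked.\<close>

definition covers :: "bool word \<Rightarrow> bool word \<Rightarrow> bool" where
  "covers p q \<longleftrightarrow> less_fun p q \<and> (\<forall>r. \<not> (less_fun p r \<and> less_fun r q))"

lemma no_word_in_gap: "\<not> (less_fun (w \<frown> False ## ones) r \<and> less_fun r (w \<frown> True ## zeros))"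
proof (induction w arbitrary: r)
  case Nil
  obtain c r' where "r = c ## r'"
    by (rule word_cases)
  then show ?case
    using not_ones_less not_less_zeros by auto
next
  case (Cons d w)
  obtain c r' where "r = c ## r'"
    by (rule word_cases)
  then show ?case
    using Cons.IH[of r'] by auto
qed

lemma covers_iff: "covers p q \<longleftrightarrow> (\<exists>w. p = w \<frown> False ## ones \<and> q = w \<frown> True ## zeros)"
proof
  assume pq: "covers p q"
  then obtain w a b where ab: "p = w \<frown> False ## a" "q = w \<frown> True ## b"
    unfolding covers_def less_fun_iff_split by blast
  have "\<not> less_fun a ones"
    using pq ab unfolding covers_def by (auto dest: spec[of _ "w \<frown> False ## ones"])
  then have "a = ones"
    using less_fun_total[of a ones] not_ones_less[of a] by metis
  moreover have "\<not> less_fun zeros b"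
    using pq ab unfolding covers_def by (auto dest: spec[of _ "w \<frown> True ## zeros"])
  then have "b = zeros"
    using less_fun_total[of b zeros] not_less_zeros[of b] by metis
  ultimately show "\<exists>w. p = w \<frown> False ## ones \<and> q = w \<frown> True ## zeros"
    using ab by blast
next
  assume "\<exists>w. p = w \<frown> False ## ones \<and> q = w \<frown> True ## zeros"
  then show "covers p q"
    unfolding covers_def using no_word_in_gap by auto
qed

lemma covers_unique: "covers p q \<Longrightarrow> covers p q' \<Longrightarrow> q = q'"
  using less_fun_total[of q q'] unfolding covers_def by blast

lemma order_homeo_covers:
  assumes "order_homeo f" "covers p q"
  shows "covers (f p) (f q)"
  unfolding covers_def
proof (intro conjI allI notI)
  show "less_fun (f p) (f q)"
    using assms order_homeo_less_iff covers_def by simp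
  fix r
  assume r: "less_fun (f p) r \<and> less_fun r (f q)"
  obtain s where "r = f s"
    using order_homeo_bij[OF assms(1)] by (metis bij_pointE)
  then show False
    using r assms unfolding covers_def by (simp add: order_homeo_less_iff)
qed

section \<open>Conjugation by \<open>\<phi>\<close>\<close>

lemma run_ne_L: "s \<noteq> St_L \<Longrightarrow> run s u \<noteq> St_L"
proof (induction u arbitrary: s)
  case (Cons b u)
  then have "snd (T_phi s b) \<noteq> St_L"
    by (cases s; cases b) auto
  then show ?case
    using Cons.IH by simp
qed simp

lemma run_L_ne_L: "True \<in> set u \<Longrightarrow> run St_L u \<noteq> St_L"
proof (induction u)
  case (Cons b u)
  then show ?case
    using run_ne_L[of St_R u] by (cases b) auto
qed simp

lemma run_L_zeros: "run St_L (Z k) = St_L"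
  by (induction k) auto

lemma out_word_L_zeros: "out_word T_phi St_L (Z k) = Z k"
  by (induction k) auto

lemma phi_at_A_zeros: "phi_at St_A (Z k \<frown> x) = Z (2 * k) \<frown> phi_at St_A x"
  by (induction k) auto

lemma phi_conc: "phi (u \<frown> x) = out_word T_phi St_L u \<frown> phi_at (run St_L u) x"
  by (simp add: phi_def phi_at_conc)

text \<open>\<open>St_L\<close> copies zeros and does not change. This lets a shift by
  \<open>Z j\<close> pass through conjugation unchanged.\<close>

lemma phi_zeros_conc: "phi (Z k \<frown> x) = Z k \<frown> phi x"
  by (simp add: phi_conc run_L_zeros out_word_L_zeros) (simp add: phi_def)

lemma phi_order_homeo: "order_homeo phi"
  unfolding phi_def by (rule phi_at_order_homeo) simp

lemma bij_phi: "bij phi"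
  by (rule order_homeo_bij[OF phi_order_homeo])

text \<open>A 0 leads every state other than \<open>St_L\<close> to \<open>St_A\<close>; after a 1,
  a further 0 leads to \<open>St_A\<close> and a further 1 to \<open>St_R\<close>. So one or two
  letters suffice.\<close>

lemma run_synchronise:
  assumes "s \<noteq> St_L" "t \<noteq> St_L"
  obtains z y where "x = z \<frown> y" "run s z = run t z" "run s z \<noteq> St_B"
proof -
  obtain a b y where x: "x = a ## b ## y"
    by (metis word_cases)
  show ?thesis
  proof (cases a)
    case False
    then show ?thesis
      using assms x by (intro that[of "[a]" "b ## y"]) (cases s; cases t; simp)+
  next
    case True
    then show ?thesis
      using assms x by (intro that[of "[a, b]" y]) (cases s; cases t; cases b; simp)+
  qed
qed

section \<open>A single conjugation step\<close>

definition conj_phi :: "(bool word \<Rightarrow> bool word) \<Rightarrow> bool word \<Rightarrow> bool word" where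
  "conj_phi f = phi \<circ> f \<circ> inv_into UNIV phi"

lemma conj_phi_phi [simp]: "conj_phi f (phi x) = phi (f x)"
  by (simp add: conj_phi_def bij_phi bij_is_inj)

text \<open>Equal end states give the same output tail after \<open>u\<close> and after
  \<open>v\<close>. As this state is not \<open>St_B\<close>, its map is onto, so every tail
  \<open>y\<close> occurs.\<close>

lemma conj_phi_replaces_prefix:
  assumes f: "\<And>x. f (u \<frown> x) = v \<frown> x" and run: "run St_L u = run St_L v" "run St_L u \<noteq> St_B"
  shows "replaces_prefix (conj_phi f) (out_word T_phi St_L u)"
  unfolding replaces_prefix_def
proof (intro exI allI)
  fix y
  obtain x where x: "y = phi_at (run St_L u) x"
    using order_homeo_bij[OF phi_at_order_homeo[OF run(2)]] by (metis bij_pointE)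
  have "conj_phi f (phi (u \<frown> x)) = phi (v \<frown> x)"
    using f by simp
  then show "conj_phi f (out_word T_phi St_L u \<frown> y) = out_word T_phi St_L v \<frown> y"
    using x run by (simp add: phi_conc)
qed

text \<open>It suffices to find around each point a replacement of \<open>u\<close> by
  \<open>v\<close> with equal end states. At \<open>zeros\<close> both words consist of zeros and
  end in \<open>St_L\<close>; elsewhere both contain a 1, and reading further synchronises
  them.\<close>

lemma conj_phi_thompson_F:
  assumes "f \<in> thompson_F"
  shows "conj_phi f \<in> thompson_F"
  unfolding thompson_F_iff
proof
  have f: "order_homeo f"
    using assms by (simp add: thompson_F_iff)
  then show "order_homeo (conj_phi f)"
    unfolding conj_phi_def by (intro order_homeo_comp phi_order_homeo order_homeo_inv)
  obtain n where n: "\<And>u. n \<le> length u \<Longrightarrow> replaces_prefix f u"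
    using assms locally_prefix_replacing_uniform by (auto simp: thompson_F_iff)
  show "locally_prefix_replacing (conj_phi f)"
  proof (rule locally_prefix_replacingI)
    fix y
    obtain x where x: "y = phi x"
      using bij_phi by (metis bij_pointE)
    have "\<exists>u v z. x = u \<frown> z \<and> (\<forall>z. f (u \<frown> z) = v \<frown> z) \<and>
        run St_L u = run St_L v \<and> run St_L u \<noteq> St_B"
    proof (cases "x = zeros")
      case True
      obtain v where v: "\<And>z. f (Z n \<frown> z) = v \<frown> z"
        using n[of "Z n"] unfolding replaces_prefix_def by auto
      have "v \<frown> zeros = zeros"
        using v[of zeros] order_homeo_zeros[OF f] by simp
      then have "v = Z (length v)"
        by (metis prefix_conc_length prefix_zeros)
      then have "run St_L v = St_L"
        using run_L_zeros by metis
      then show ?thesis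
        using v True by (intro exI[of _ "Z n"] exI[of _ v] exI[of _ zeros]) (simp add: run_L_zeros)
    next
      case False
      then obtain i where i: "x i"
        by auto
      \<comment> \<open>This length includes the 1 at position \<open>i\<close> and is at least
        \<open>n\<close>.\<close>
      define u where "u = prefix (Suc i + n) x"
      define x' where "x' = suffix (Suc i + n) x"
      have xu: "x = u \<frown> x'"
        by (simp add: u_def x'_def)
      have u: "True \<in> set u"
        using i unfolding u_def set_subsequence by (intro image_eqI[of _ _ i]) auto
      obtain v where v: "\<And>z. f (u \<frown> z) = v \<frown> z"
        using n[of u] unfolding replaces_prefix_def u_def by auto
      \<comment> \<open>Otherwise \<open>f\<close> would send \<open>u \<frown> zeros\<close>, which
        contains a 1, to \<open>zeros\<close>, the image of \<open>zeros\<close> itself.\<close>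
      have "True \<in> set v"
      proof (rule ccontr)
        assume "True \<notin> set v"
        then have "v = Z (length v)"
          by (metis (full_types) replicate_eqI)
        then have "f (u \<frown> zeros) = zeros"
          using v[of zeros] by (metis replicate_conc_const)
        then have "u \<frown> zeros = zeros"
          using order_homeo_zeros[OF f] order_homeo_bij[OF f] by (metis bij_is_inj injD)
        then have "u = Z (length u)"
          by (metis prefix_conc_length prefix_zeros)
        then show False
          using u by (metis in_set_replicate)
      qed
      then obtain z y' where z: "x' = z \<frown> y'"
          "run (run St_L u) z = run (run St_L v) z" "run (run St_L u) z \<noteq> St_B"
        using run_synchronise[of "run St_L u" "run St_L v" x'] run_L_ne_L u by metis
      have "f ((u @ z) \<frown> y) = (v @ z) \<frown> y" for y
        using v[of "z \<frown> y"] by simp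
      then show ?thesis
        using xu z by (intro exI[of _ "u @ z"] exI[of _ "v @ z"] exI[of _ y']) simp
    qed
    then obtain u v z where uv: "x = u \<frown> z" "\<And>z. f (u \<frown> z) = v \<frown> z"
        "run St_L u = run St_L v" "run St_L u \<noteq> St_B"
      by blast
    then show "\<exists>w y'. y = w \<frown> y' \<and> replaces_prefix (conj_phi f) w"
      using conj_phi_replaces_prefix[OF uv(2-4)] phi_conc x by blast
  qed
qed

text \<open>As an iterate of one conjugation, \<open>conj_F i\<close> becomes accessible to
  induction on \<open>i\<close>.\<close>

lemma conj_F_eq: "conj_F i = (conj_phi ^^ i) ` thompson_F"
proof -
  have "bij (phi ^^ i)" for i
    by (induction i) (simp_all only: funpow.simps bij_id bij_comp bij_phi)
  then have "(conj_phi ^^ i) f = (phi ^^ i) \<circ> f \<circ> inv_into UNIV (phi ^^ i)" for f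
    by (induction i) (simp_all add: conj_phi_def o_inv_distrib bij_phi comp_assoc)
  then show ?thesis
    unfolding conj_F_def by auto
qed

lemma conj_F_0: "conj_F 0 = thompson_F"
  by (simp add: conj_F_eq)

lemma conj_F_Suc: "conj_F (Suc i) = conj_phi ` conj_F i"
  by (auto simp: conj_F_eq)

lemma inj_conj_phi: "inj conj_phi"
proof (rule injI, rule ext)
  fix f g x
  assume "conj_phi f = conj_phi g"
  then have "phi (f x) = phi (g x)"
    by (metis conj_phi_phi)
  then show "f x = g x"
    using bij_phi by (simp add: bij_is_inj inj_eq)
qed

section \<open>The groups \<open>conj_F i\<close>\<close>

lemma conj_F_subset_thompson_F: "conj_F i \<subseteq> thompson_F"
  by (induction i) (auto simp: conj_F_0 conj_F_Suc conj_phi_thompson_F)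

lemma conj_phi_id: "conj_phi id = id"
  using surj_iff[THEN iffD1, OF bij_is_surj[OF bij_phi]] by (simp add: conj_phi_def)

lemma conj_phi_comp: "conj_phi f \<circ> conj_phi g = conj_phi (f \<circ> g)"
  using bij_phi by (simp add: conj_phi_def fun_eq_iff bij_is_inj)

lemma conj_phi_inv:
  assumes "bij f"
  shows "inv_into UNIV (conj_phi f) = conj_phi (inv_into UNIV f)"
proof (rule inv_unique_comp)
  show "conj_phi f \<circ> conj_phi (inv_into UNIV f) = id"
    using surj_iff[THEN iffD1, OF bij_is_surj[OF assms]] by (simp only: conj_phi_comp conj_phi_id)
  show "conj_phi (inv_into UNIV f) \<circ> conj_phi f = id"
    using inv_o_cancel[OF bij_is_inj[OF assms]] by (simp only: conj_phi_comp conj_phi_id)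
qed

lemma conj_F_bij: "f \<in> conj_F i \<Longrightarrow> bij f"
  using conj_F_subset_thompson_F order_homeo_bij thompson_F_iff by blast

lemma conj_F_id: "id \<in> conj_F i"
proof (induction i)
  case (Suc i)
  then show ?case
    unfolding conj_F_Suc by (metis conj_phi_id imageI)
qed (simp only: conj_F_0 thompson_F_id)

lemma conj_F_comp: "f \<in> conj_F i \<Longrightarrow> g \<in> conj_F i \<Longrightarrow> f \<circ> g \<in> conj_F i"
  by (induction i arbitrary: f g) (auto simp: conj_F_0 conj_F_Suc conj_phi_comp thompson_F_comp)

lemma conj_F_inv: "f \<in> conj_F i \<Longrightarrow> inv_into UNIV f \<in> conj_F i"
proof (induction i arbitrary: f)
  case (Suc i)
  then obtain g where "g \<in> conj_F i" "f = conj_phi g"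
    by (auto simp: conj_F_Suc)
  then show ?case
    using Suc.IH[of g] conj_phi_inv[of g] conj_F_bij by (simp add: conj_F_Suc)
qed (simp add: conj_F_0 thompson_F_inv)

lemma conj_F_subgroup: "subgroup (conj_F i) (BijGroup UNIV)"
proof -
  have Bij: "f \<in> Bij UNIV" if "f \<in> conj_F i" for f
    using conj_F_bij[OF that] by (simp add: Bij_def)
  show ?thesis
  proof (rule group.subgroupI[OF group_BijGroup])
    show "conj_F i \<subseteq> carrier (BijGroup UNIV)"
      using Bij by (auto simp: BijGroup_def)
    show "conj_F i \<noteq> {}"
      using conj_F_id by blast
    show "m_inv (BijGroup UNIV) f \<in> conj_F i" if "f \<in> conj_F i" for f
      using conj_F_inv[OF that] Bij[OF that] by (simp add: inv_BijGroup restrict_def)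
    show "f \<otimes>\<^bsub>BijGroup UNIV\<^esub> g \<in> conj_F i" if "f \<in> conj_F i" "g \<in> conj_F i" for f g
    proof -
      have "f \<otimes>\<^bsub>BijGroup UNIV\<^esub> g = f \<circ> g"
        using Bij that by (simp add: BijGroup_def compose_def comp_def restrict_def)
      then show ?thesis
        using conj_F_comp that by simp
    qed
  qed
qed

section \<open>Triviality of the intersection\<close>

lemma conc_zeros_eq_imp:
  assumes "v \<frown> zeros = u \<frown> zeros" "length u \<le> length v"
  shows "v = u @ Z (length v - length u)"
proof -
  have "v = prefix (length v) (u \<frown> zeros)"
    using assms(1) by (metis prefix_conc_length)
  then show ?thesis
    using assms(2) by (simp add: prefix_zeros)
qed

lemma Z_conc_ones_eq: "Z m \<frown> ones = Z n \<frown> ones \<Longrightarrow> m = n"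
proof (induction m arbitrary: n)
  case 0
  then show ?case
    by (cases n) (auto simp: fun_eq_iff dest: spec[of _ 0])
next
  case (Suc m)
  have "n \<noteq> 0"
  proof
    assume "n = 0"
    then have "(Z (Suc m) \<frown> ones) 0 = ones 0"
      using Suc.prems by simp
    then show False
      by simp
  qed
  then show ?case
    using Suc by (cases n) auto
qed

lemma conc_left_cancel:
  fixes u v :: "bool list"
  assumes "\<And>x. u \<frown> x = v \<frown> x"
  shows "u = v"
  using assms
proof (induction u arbitrary: v)
  case Nil
  show ?case
  proof (cases v)
    case (Cons b w)
    then show ?thesis
      using Nil[of "(\<not> b) ## undefined"] by simp
  qed simp
next
  case (Cons a u)
  show ?case
  proof (cases v)
    case Nil
    then show ?thesis
      using Cons.prems[of "(\<not> a) ## undefined"] by simp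
  next
    case (Cons b w)
    then show ?thesis
      using Cons.prems Cons.IH[of w] by simp
  qed
qed

text \<open>The words \<open>v'\<close> and \<open>v\<close> describe the same dyadic point, so they
  agree up to trailing zeros, and padding expresses the replacement through \<open>u\<close> and
  \<open>v\<close>. Both exponents are positive because a first 0 is later spent on reaching
  \<open>St_A\<close>.\<close>

lemma prefix_replacement_at_dyadic:
  assumes "locally_prefix_replacing g" "g (u \<frown> zeros) = v \<frown> zeros"
  obtains b c where "\<And>x. g ((u @ Z (Suc b)) \<frown> x) = (v @ Z (Suc c)) \<frown> x"
proof -
  obtain n where n: "\<And>u. n \<le> length u \<Longrightarrow> replaces_prefix g u"
    using assms(1) locally_prefix_replacing_uniform by blast
  obtain v' where v': "\<And>x. g ((u @ Z n) \<frown> x) = v' \<frown> x"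
    using n[of "u @ Z n"] unfolding replaces_prefix_def by auto
  \<comment> \<open>With this padding \<open>v' @ Z t\<close> is longer than \<open>v\<close>, by
    exactly \<open>Suc (length v')\<close> letters.\<close>
  define t where "t = Suc (length v)"
  have "v' \<frown> zeros = v \<frown> zeros"
    using v'[of zeros] assms(2) by (simp flip: conc_conc)
  then have "(v' @ Z t) \<frown> zeros = v \<frown> zeros"
    by (simp flip: conc_conc)
  then have "v' @ Z t = v @ Z (length v' + t - length v)"
    using conc_zeros_eq_imp[of "v' @ Z t" v] by (simp add: t_def)
  moreover have "length v' + t - length v = Suc (length v')"
    by (simp add: t_def)
  ultimately have eq: "v' @ Z t = v @ Z (Suc (length v'))"
    by simp
  have "g ((u @ Z (n + t)) \<frown> x) = (v' @ Z t) \<frown> x" for x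
    using v'[of "Z t \<frown> x"] by (simp add: replicate_add)
  moreover have "n + t = Suc (n + length v)"
    by (simp add: t_def)
  ultimately show ?thesis
    using that[of "n + length v" "length v'"] eq by metis
qed

text \<open>Up to the shift by \<open>Z j\<close>, the difference \<open>c - b\<close> measures the
  scaling of \<open>f\<close> just to the right of the point. It depends on the germ there and not
  on the words chosen, and one conjugation doubles it.\<close>

lemma germ_exponent_divisible:
  assumes "f \<in> conj_F i"
    and "\<And>x. f ((w @ True # Z b) \<frown> x) = (Z j @ w @ True # Z c) \<frown> x"
  shows "(2 :: int) ^ i dvd int c - int b"
  using assms
proof (induction i arbitrary: f w b c)
  case (Suc i)
  define W where "W = w @ [True]"
  have f: "f (W \<frown> Z b \<frown> x) = Z j \<frown> W \<frown> Z c \<frown> x" for x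
    using Suc.prems(2)[of x] by (simp add: W_def flip: conc_conc)
  obtain g where g: "g \<in> conj_F i" "f = conj_phi g"
    using Suc.prems(1) by (auto simp: conj_F_Suc)
  have gF: "order_homeo g" "locally_prefix_replacing g"
    using g(1) conj_F_subset_thompson_F thompson_F_iff by blast+
  obtain p where p: "phi p = W \<frown> zeros"
    using bij_phi by (metis bij_pointE)
  \<comment> \<open>Since \<open>phi p\<close> is the right end of a gap, so is \<open>p\<close>;
    hence \<open>p\<close> is again dyadic.\<close>
  have "covers (w \<frown> False ## ones) (phi p)"
    unfolding p covers_iff W_def by auto
  then have "covers (inv_into UNIV phi (w \<frown> False ## ones)) p"
    using order_homeo_covers[OF order_homeo_inv[OF phi_order_homeo]] bij_phi
    by (metis bij_is_inj inv_f_f)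
  then obtain w' where "p = w' \<frown> True ## zeros"
    unfolding covers_iff by blast
  define W' where "W' = w' @ [True]"
  have pW': "p = W' \<frown> zeros"
    using \<open>p = _\<close> by (simp add: W'_def)
  \<comment> \<open>Since \<open>phi\<close> commutes with prepending zeros, \<open>g\<close> acts
    on \<open>p\<close> by the same shift as \<open>f\<close> on \<open>phi p\<close>.\<close>
  have "phi (g p) = phi (Z j \<frown> p)"
    using f[of zeros] g(2) p by (simp add: phi_zeros_conc flip: conc_conc) (metis conj_phi_phi)
  then have "g p = Z j \<frown> p"
    using bij_phi by (metis bij_is_inj injD)
  then have "g (W' \<frown> zeros) = (Z j @ W') \<frown> zeros"
    using pW' by simp
  then obtain b' c' where g': "\<And>x. g ((W' @ Z (Suc b')) \<frown> x) = ((Z j @ W') @ Z (Suc c')) \<frown> x"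
    using prefix_replacement_at_dyadic[OF gF(2)] by blast
  have dvd: "(2 :: int) ^ i dvd int (Suc c') - int (Suc b')"
    using g' by (intro Suc.IH[OF g(1), of w' "Suc b'" "Suc c'"]) (simp add: W'_def)
  \<comment> \<open>\<open>V\<close> and \<open>W\<close> describe the same dyadic point, with possibly different numbers of trailing zeros\<close>
  define V where "V = out_word T_phi St_L (W' @ [False])"
  have "run St_L W' \<noteq> St_L"
    by (rule run_L_ne_L) (simp add: W'_def)
  then have "run St_L (W' @ [False]) = St_A"
    by (cases "run St_L W'") auto
  \<comment> \<open>The first 0 after \<open>W'\<close> leads to \<open>St_A\<close>, and the
    remaining \<open>k\<close> zeros are doubled.\<close>
  then have phiW': "phi ((W' @ Z (Suc k)) \<frown> x) = V \<frown> Z (2 * k) \<frown> phi_at St_A x" for k x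
    using phi_conc[of "W' @ [False]" "Z k \<frown> x"] by (simp add: V_def phi_at_A_zeros del: foldl_append)
  have V: "f (V \<frown> Z (2 * b') \<frown> y) = Z j \<frown> V \<frown> Z (2 * c') \<frown> y" for y
  proof -
    obtain x where x: "y = phi_at St_A x"
      using order_homeo_bij[OF phi_at_order_homeo[of St_A]] by (metis bij_pointE state.distinct(11))
    have "f (phi ((W' @ Z (Suc b')) \<frown> x)) = phi (Z j \<frown> (W' @ Z (Suc c')) \<frown> x)"
      unfolding g(2) conj_phi_phi g' by (simp flip: conc_conc)
    then show ?thesis
      unfolding phi_zeros_conc phiW' x .
  qed
  have "V \<frown> zeros = W \<frown> zeros"
  proof -
    have "phi_at St_A zeros = zeros"
      by (rule order_homeo_zeros[OF phi_at_order_homeo]) simp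
    then show ?thesis
      using phiW'[of 0 zeros] p pW' by simp
  qed
  then have "(V @ Z (length W)) \<frown> zeros = W \<frown> zeros"
    by (simp flip: conc_conc)
  then have VW: "V @ Z (length W) = W @ Z (length V)"
    using conc_zeros_eq_imp[of "V @ Z (length W)" W] by simp
  have shift: "V \<frown> Z k \<frown> Z (length W) \<frown> x = W \<frown> Z (length V + k) \<frown> x" for k x
  proof -
    have "V \<frown> Z k \<frown> Z (length W) \<frown> x = (V @ Z (length W)) \<frown> Z k \<frown> x"
      by (simp add: add.commute flip: replicate_add)
    then show ?thesis
      unfolding VW by (simp add: replicate_add)
  qed
  \<comment> \<open>The value of \<open>f\<close> at one point is computed in two ways, via
    \<open>V\<close> and via \<open>W\<close>; the tail \<open>ones\<close> makes the numbers of
    zeros comparable.\<close>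
  have "Z j \<frown> W \<frown> Z (length V + 2 * c' + b) \<frown> ones = Z j \<frown> V \<frown> Z (2 * c') \<frown> Z (length W) \<frown> Z b \<frown> ones"
    unfolding shift by (simp add: replicate_add)
  also have "\<dots> = f (V \<frown> Z (2 * b') \<frown> Z (length W) \<frown> Z b \<frown> ones)"
    unfolding V ..
  also have "\<dots> = f (W \<frown> Z b \<frown> Z (length V + 2 * b') \<frown> ones)"
    unfolding shift by (simp add: add.commute flip: replicate_add)
  also have "\<dots> = Z j \<frown> W \<frown> Z (c + length V + 2 * b') \<frown> ones"
    unfolding f by (simp add: replicate_add)
  finally have "Z (length V + 2 * c' + b) \<frown> ones = Z (c + length V + 2 * b') \<frown> ones"
    by (simp only: same_concat_eq)
  then have "length V + 2 * c' + b = c + length V + 2 * b'"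
    by (rule Z_conc_ones_eq)
  then have "int (2 * c' + b) = int (c + 2 * b')"
    by simp
  then have "int c - int b = 2 * (int (Suc c') - int (Suc b'))"
    by simp
  then show ?case
    using dvd by (simp only: power_Suc mult_dvd_mono dvd_refl)
qed simp

section \<open>Vanishing exponents and the sweep through the cylinders\<close>

lemma eq_0_if_all_powers_dvd:
  assumes "\<And>i. (2 :: int) ^ i dvd d"
  shows "d = 0"
proof (rule ccontr)
  assume "d \<noteq> 0"
  then have "2 ^ nat \<bar>d\<bar> \<le> \<bar>d\<bar>"
    using dvd_imp_le_int[OF _ assms[of "nat \<bar>d\<bar>"]] by simp
  moreover have "\<bar>d\<bar> < 2 ^ nat \<bar>d\<bar>"
    using of_nat_less_two_power[of "nat \<bar>d\<bar>", where 'a = int] by simp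
  ultimately show False
    by simp
qed

text \<open>Well-founded induction along the lexicographic order on words of length
  \<open>n + k\<close>: the hypothesis on \<open>Z k\<close> settles the first cylinder, and the gap
  before each further cylinder carries the shift across.\<close>

lemma Inter_conj_F_eq_shift:
  assumes f: "f \<in> (\<Inter>i. conj_F i)" and k: "\<And>x. f (Z k \<frown> x) = Z (j + k) \<frown> x"
  shows "f x = Z j \<frown> x"
proof -
  have fF: "order_homeo f" "locally_prefix_replacing f"
    using f conj_F_0 thompson_F_iff by blast+
  obtain n where n: "\<And>u. n \<le> length u \<Longrightarrow> replaces_prefix f u"
    using fF(2) locally_prefix_replacing_uniform by blast
  have wf: "wf (lex {(False, True)})"
    by (intro wf_lex wf_subset[OF wf_measure[of "\<lambda>b. if b then 1 else 0"]]) auto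
  have "\<forall>x. f (u \<frown> x) = Z j \<frown> u \<frown> x" if "length u = n + k" for u
    using wf that
  proof (induction u rule: wf_induct_rule)
    case (less u)
    show ?case
    proof (cases "True \<in> set u")
      case False
      then have "u = Z k @ Z n"
        using less.prems by (metis (full_types) add.commute replicate_add replicate_eqI)
      then show ?thesis
        using k[of "Z n \<frown> x" for x] by (simp add: replicate_add)
    next
      case True
      then obtain w z where u: "u = w @ True # z" "True \<notin> set z"
        by (meson split_list_last)
      define b where "b = length z"
      have z: "z = Z b"
        using u(2) unfolding b_def by (metis (full_types) replicate_eqI)
      \<comment> \<open>\<open>u'\<close> immediately precedes \<open>u\<close> among words of this
        length, so \<open>u' \<frown> ones\<close> and \<open>u \<frown> zeros\<close> bound a
        gap.\<close>
      define u' where "u' = w @ False # replicate b True"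
      have "(u', u) \<in> lex {(False, True)}"
        unfolding lex_conv u'_def u(1) z by auto
      moreover have "length u' = n + k"
        using less.prems by (simp add: u'_def u(1) z)
      ultimately have "f (u' \<frown> ones) = Z j \<frown> u' \<frown> ones"
        using less.IH by blast
      then have "f (w \<frown> False ## ones) = (Z j @ w) \<frown> False ## ones"
        by (simp add: u'_def flip: conc_conc)
      then have "covers ((Z j @ w) \<frown> False ## ones) (f (w \<frown> True ## zeros))"
        using order_homeo_covers[OF fF(1)] covers_iff by metis
      moreover have "covers ((Z j @ w) \<frown> False ## ones) ((Z j @ w) \<frown> True ## zeros)"
        unfolding covers_iff by blast
      ultimately have "f (w \<frown> True ## zeros) = (Z j @ w) \<frown> True ## zeros"
        by (rule covers_unique)
      then have "f ((w @ [True]) \<frown> zeros) = (Z j @ w @ [True]) \<frown> zeros"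
        by (simp flip: conc_conc)
      then obtain b' c' where bc: "\<And>x. f (((w @ [True]) @ Z (Suc b')) \<frown> x) = ((Z j @ w @ [True]) @ Z (Suc c')) \<frown> x"
        using prefix_replacement_at_dyadic[OF fF(2)] by blast
      have "int (Suc c') - int (Suc b') = 0"
      proof (rule eq_0_if_all_powers_dvd)
        fix i
        show "(2 :: int) ^ i dvd int (Suc c') - int (Suc b')"
          using f bc by (intro germ_exponent_divisible[of f i w _ j]) auto
      qed
      then have eq: "f (((w @ [True]) @ Z (Suc b')) \<frown> x) = ((Z j @ w @ [True]) @ Z (Suc b')) \<frown> x" for x
        using bc by simp
      obtain v where v: "\<And>x. f (u \<frown> x) = v \<frown> x"
        using n[of u] less.prems unfolding replaces_prefix_def by auto
      \<comment> \<open>The shift is known only on a smaller cylinder at the left end of that of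
        \<open>u\<close>, whereas \<open>f\<close> replaces \<open>u\<close> by \<open>v\<close>
        throughout. Comparing both there identifies \<open>v\<close>.\<close>
      have "v @ Z (Suc b') = (Z j @ u) @ Z (Suc b')"
      proof (rule conc_left_cancel)
        fix x
        have comm: "Z b \<frown> Z (Suc b') \<frown> x = Z (Suc b') \<frown> Z b \<frown> x"
          by (simp only: conc_conc replicate_add[symmetric] add.commute)
        have "(v @ Z (Suc b')) \<frown> x = f (u \<frown> Z (Suc b') \<frown> x)"
          unfolding v by (simp only: conc_conc)
        also have "u \<frown> Z (Suc b') \<frown> x = (w @ [True]) \<frown> Z b \<frown> Z (Suc b') \<frown> x"
          by (simp add: u z)
        also have "\<dots> = ((w @ [True]) @ Z (Suc b')) \<frown> Z b \<frown> x"
          unfolding comm by (simp only: conc_conc append_assoc)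
        also have "f \<dots> = (Z j @ w @ [True]) \<frown> Z (Suc b') \<frown> Z b \<frown> x"
          unfolding eq by (simp only: conc_conc append_assoc)
        also have "\<dots> = ((Z j @ u) @ Z (Suc b')) \<frown> x"
          unfolding comm[symmetric] by (simp add: u z flip: conc_conc)
        finally show "(v @ Z (Suc b')) \<frown> x = ((Z j @ u) @ Z (Suc b')) \<frown> x" .
      qed
      then show ?thesis
        using v by simp
    qed
  qed
  then show ?thesis
    using prefix_suffix[of x "n + k"] by (metis subsequence_length diff_zero)
qed

text \<open>The map is the shift by \<open>n - m\<close> zeros. As \<open>ones\<close> must have a
  preimage, no zero is prepended.\<close>

lemma Inter_conj_F_shift_imp_id:
  assumes f: "f \<in> (\<Inter>i. conj_F i)" and mn: "\<And>x. f (Z m \<frown> x) = Z n \<frown> x" "m \<le> n"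
  shows "f = id"
proof -
  have shift: "f x = Z (n - m) \<frown> x" for x
    using Inter_conj_F_eq_shift[OF f, of m "n - m"] mn by simp
  obtain x where "f x = ones"
    using f conj_F_bij by (metis INT_iff UNIV_I bij_pointE)
  then have "Z (n - m) \<frown> x = Z 0 \<frown> ones"
    using shift by simp
  then have "n - m = 0"
    by (cases "n - m") (auto simp: fun_eq_iff dest: spec[of _ 0])
  then show ?thesis
    using shift by auto
qed

lemma Inter_conj_F: "(\<Inter>i. conj_F i) = {id}"
proof
  show "{id} \<subseteq> (\<Inter>i. conj_F i)"
    using conj_F_id by blast
  show "(\<Inter>i. conj_F i) \<subseteq> {id}"
  proof
    fix f
    assume f: "f \<in> (\<Inter>i. conj_F i)"
    then have fF: "order_homeo f" "locally_prefix_replacing f"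
      using conj_F_0 thompson_F_iff by blast+
    obtain m where "replaces_prefix f (Z m)"
      using locally_prefix_replacing_uniform[OF fF(2)] by (metis length_replicate order_refl)
    then obtain v where v: "\<And>x. f (Z m \<frown> x) = v \<frown> x"
      unfolding replaces_prefix_def by blast
    have "v \<frown> zeros = zeros"
      using v[of zeros] order_homeo_zeros[OF fF(1)] by simp
    then have "v = Z (length v)"
      by (metis prefix_conc_length prefix_zeros)
    then obtain n where n: "\<And>x. f (Z m \<frown> x) = Z n \<frown> x"
      using v by metis
    have "f = id"
    proof (cases "m \<le> n")
      case True
      then show ?thesis
        using Inter_conj_F_shift_imp_id[OF f] n by blast
    next
      \<comment> \<open>Here \<open>f\<close> removes leading zeros, so its inverse, which also lies
        in the intersection, prepends them.\<close>
      case False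
      have "bij f"
        by (rule order_homeo_bij[OF fF(1)])
      then have "inv_into UNIV f (Z n \<frown> x) = Z m \<frown> x" for x
        using n by (metis bij_inv_eq_iff)
      moreover have "inv_into UNIV f \<in> (\<Inter>i. conj_F i)"
        using f conj_F_inv by blast
      ultimately have "inv_into UNIV f = id"
        using Inter_conj_F_shift_imp_id[of "inv_into UNIV f" n m] False by simp
      then show ?thesis
        using \<open>bij f\<close> by (metis inv_id inv_inv_eq)
    qed
    then show "f \<in> {id}"
      by simp
  qed
qed

section \<open>Strictness of the chain\<close>

lemma thompson_F_nontrivial: "thompson_F \<noteq> {id}"
proof -
  \<comment> \<open>the standard generator \<open>0 \<mapsto> 00, 10 \<mapsto> 01, 11 \<mapsto> 1\<close>\<close>
  define f where "f = phi_at St_A \<circ> inv_into UNIV (phi_at St_R)"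
  have A: "order_homeo (phi_at St_A)" and R: "order_homeo (phi_at St_R)"
    by (simp_all add: phi_at_order_homeo)
  have f_phi: "f (phi_at St_R x) = phi_at St_A x" for x
    using order_homeo_bij[OF R] by (simp add: f_def bij_is_inj)
  have surj: "\<exists>x. y = phi_at St_A x" "\<exists>x. y = phi_at St_R x" for y
    using order_homeo_bij A R by (metis bij_pointE)+
  \<comment> \<open>From \<open>St_R\<close> and \<open>St_A\<close>, each of the inputs 0, 10 and
    11 leads to a common state, so \<open>f\<close> merely exchanges the words written; surjectivity
    of that state's map supplies every tail \<open>y\<close>.\<close>
  have f0: "f (False ## y) = False ## False ## y" for y
    using surj(1)[of y] f_phi[of "False ## x" for x] by auto
  have f10: "f (True ## False ## y) = False ## True ## y" for y
    using surj(1)[of y] f_phi[of "True ## False ## x" for x] by auto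
  have f11: "f (True ## True ## y) = True ## y" for y
    using surj(2)[of y] f_phi[of "True ## True ## x" for x] by auto
  have "locally_prefix_replacing f"
  proof (rule locally_prefix_replacingI)
    fix x :: "bool word"
    obtain a b y where x: "x = a ## b ## y"
      by (metis word_cases)
    have "replaces_prefix f [a, b]"
      unfolding replaces_prefix_def
    proof (cases a; cases b)
      show "\<exists>v. \<forall>x. f ([a, b] \<frown> x) = v \<frown> x" if "a" "b"
        using that f11 by (intro exI[of _ "[True]"]) simp
      show "\<exists>v. \<forall>x. f ([a, b] \<frown> x) = v \<frown> x" if "a" "\<not> b"
        using that f10 by (intro exI[of _ "[False, True]"]) simp
      show "\<exists>v. \<forall>x. f ([a, b] \<frown> x) = v \<frown> x" if "\<not> a" "b"
        using that f0 by (intro exI[of _ "[False, False, b]"]) simp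
      show "\<exists>v. \<forall>x. f ([a, b] \<frown> x) = v \<frown> x" if "\<not> a" "\<not> b"
        using that f0 by (intro exI[of _ "[False, False, b]"]) simp
    qed
    then show "\<exists>u y. x = u \<frown> y \<and> replaces_prefix f u"
      using x by (intro exI[of _ "[a, b]"] exI[of _ y]) simp
  qed
  moreover have "order_homeo f"
    unfolding f_def by (intro order_homeo_comp order_homeo_inv A R)
  ultimately have "f \<in> thompson_F"
    by (simp add: thompson_F_iff)
  moreover have "f \<noteq> id"
    using f10[of undefined] by auto
  ultimately show ?thesis
    by blast
qed

lemma conj_F_Suc_psubset: "conj_F (Suc i) \<subset> conj_F i"
proof (induction i)
  case 0
  have "conj_F (Suc 0) \<noteq> conj_F 0"
  proof
    assume eq: "conj_F (Suc 0) = conj_F 0"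
    \<comment> \<open>Applying \<open>conj_phi\<close> repeatedly to the assumed equality collapses
      the whole chain.\<close>
    have "conj_F k = conj_F 0" for k
      by (induction k) (use eq in \<open>simp_all add: conj_F_Suc\<close>)
    then have "(\<Inter>k. conj_F k) = thompson_F"
      using conj_F_0 by auto
    then show False
      using Inter_conj_F thompson_F_nontrivial by simp
  qed
  then show ?case
    using conj_F_subset_thompson_F[of "Suc 0"] conj_F_0 by blast
next
  case (Suc i)
  then show ?case
    unfolding conj_F_Suc[of "Suc i"] conj_F_Suc[of i]
    by (metis conj_F_Suc image_strict_mono inj_conj_phi inj_on_subset subset_UNIV)
qed

theorem theorem6p8:
  shows "conj_F 0 = thompson_F
    \<and> (\<forall>i. subgroup (conj_F i) (BijGroup UNIV))
    \<and> (\<forall>i. conj_F (Suc i) \<subset> conj_F i)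
    \<and> (\<Inter>i. conj_F i) = {id}"
  using conj_F_0 conj_F_subgroup conj_F_Suc_psubset Inter_conj_F by blast

end
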